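(* Let $\Lambda$ be a finitely aligned $k$-graph with path space $W$. Define $\alpha: W\to\{0,1\}^{\Lambda}$ by $\alpha(w)(y)=1$ if $w\in\mathcal Z(y)$ and $\alpha(w)(y)=0$ otherwise (for $w\in W$, $y\in\Lambda$), where $\{0,1\}^\Lambda$ carries the product topology. Then the collection $$\Big\{\mathcal Z(\mu\setminus G) : \mu\in\Lambda \text{ and } G\subset \bigcup_{i=1}^k \big(s(\mu)\Lambda^{e_i}\big)\text{ is finite}\Big\}$$ is a base for the initial topology on $W$ induced by $\{\alpha\}$.
   Context: Conventions: $\mathbb N=\{0,1,2,\dots\}$; $e_1,\dots,e_k$ are the standard generators of $\mathbb N^k$; $(\mathbb N\cup\{\infty\})^k$ is ordered coordinatewise; $\wedge,\vee$ are coordinatewise minimum and maximum. A $k$-graph is a countable category $\Lambda$ with a functor $d:\Lambda\to\mathbb N^k$ (degree) satisfying the factorisation property: whenever $d(\lambda)=m+n$ there are unique $\mu,\nu$ with $\lambda=\mu\nu$, $d(\mu)=m$, $d(\nu)=n$. Morphisms are called paths, $\lambda\in\Lambda$ means $\lambda$ is a morphism, $r,s$ are codomain and domain ($\lambda\mu$ is defined iff $s(\lambda)=r(\mu)$). $\Lambda^n=d^{-1}(n)$, and $\Lambda^0$ is identified with the objects (vertices). $vF=\{\lambda\in F: r(\lambda)=v\}$. A $k$-graph morphism is a degree-preserving functor. For $m\in(\mathbb N\cup\{\infty\})^k$, $\Omega_{k,m}$ is the $k$-graph with objects $p\in\mathbb N^k$, $p\le m$, morphisms $(p,q)$ with $p\le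 q\le m$, $r(p,q)=p$, $s(p,q)=q$, $d(p,q)=q-p$, $(p,q)(q,t)=(p,t)$. $\Lambda^m$ also denotes the set of $k$-graph morphisms $x:\Omega_{k,m}\to\Lambda$, and $d(x):=m$; for $m\in\mathbb N^k$ these are identified with the paths $\lambda$ of degree $m$, where $\lambda(p,q)$ is the unique $\lambda''$ with $\lambda=\lambda'\lambda''\lambda'''$, $d(\lambda')=p$, $d(\lambda'')=q-p$. The path space is $W=W_\Lambda=\bigcup_{m\in(\mathbb N\cup\{\infty\})^k}\Lambda^m$. $\mathrm{MCE}(\mu,\nu)$ is the set of $\lambda\in\Lambda$ with $\lambda=\mu\alpha=\nu\beta$ for some $\alpha,\beta\in\Lambda$ and $d(\lambda)=d(\mu)\vee d(\nu)$. $\Lambda$ is finitely aligned if $\mathrm{MCE}(\mu,\nu)$ is finite (possibly empty) for all $\mu,\nu\in\Lambda$. Cylinder sets: $\mathcal Z(\mu)=\{x\in W: d(x)\ge d(\mu),\ x(0,d(\mu))=\mu\}$ for $\mu\in\Lambda$; for finite $G\subset s(\mu)\Lambda$, $\mathcal Z(\mu\setminus G)=\mathcal Z(\mu)\setminus\bigcup_{\nu\in G}\mathcal Z(\mu\nu)$. *)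

theory Defs
  imports "HOL-Analysis.Analysis" "HOL-Library.Function_Algebras"
begin

text \<open>
  The monoid \<open>\<nat>\<^sup>k\<close> is encoded as the set of functions \<open>nat \<Rightarrow> nat\<close> that vanish from index \<open>k\<close> on, so
  coordinates are indexed by \<open>0, \<dots>, k - 1\<close>; likewise for \<open>(\<nat> \<union> {\<infinity>})\<^sup>k\<close>.  Addition, subtraction, order
  and \<open>sup\<close> are the pointwise library operations on functions.
\<close>

definition Nk :: "nat \<Rightarrow> (nat \<Rightarrow> nat) set"
  where "Nk k = {n. \<forall>i\<ge>k. n i = 0}"

definition Nk_inf :: "nat \<Rightarrow> (nat \<Rightarrow> enat) set"
  where "Nk_inf k = {m. \<forall>i\<ge>k. m i = 0}"

definition emb :: "(nat \<Rightarrow> nat) \<Rightarrow> (nat \<Rightarrow> enat)"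
  where "emb n = (\<lambda>i. enat (n i))"

definition unit_deg :: "nat \<Rightarrow> (nat \<Rightarrow> nat)"
  where "unit_deg i = (\<lambda>j. if j = i then 1 else 0)"

text \<open>
  Categories are presented by their morphisms alone, objects being identified with identity
  morphisms (in a \<open>k\<close>-graph these are exactly the morphisms of degree \<open>0\<close>).  The term \<open>cmp \<Lambda> \<lambda> \<mu>\<close>
  is only meaningful when \<open>src \<Lambda> \<lambda> = rng \<Lambda> \<mu>\<close>.
\<close>

record 'a graph_data =
  mor :: "'a set"
  rng :: "'a \<Rightarrow> 'a"
  src :: "'a \<Rightarrow> 'a"
  cmp :: "'a \<Rightarrow> 'a \<Rightarrow> 'a"
  deg :: "'a \<Rightarrow> (nat \<Rightarrow> nat)"

locale small_category =
  fixes \<Lambda> :: "('a, 'b) graph_data_scheme"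
  assumes rng_closed: "f \<in> mor \<Lambda> \<Longrightarrow> rng \<Lambda> f \<in> mor \<Lambda>"
    and src_closed: "f \<in> mor \<Lambda> \<Longrightarrow> src \<Lambda> f \<in> mor \<Lambda>"
    and rng_rng: "f \<in> mor \<Lambda> \<Longrightarrow> rng \<Lambda> (rng \<Lambda> f) = rng \<Lambda> f"
    and src_rng: "f \<in> mor \<Lambda> \<Longrightarrow> src \<Lambda> (rng \<Lambda> f) = rng \<Lambda> f"
    and rng_src: "f \<in> mor \<Lambda> \<Longrightarrow> rng \<Lambda> (src \<Lambda> f) = src \<Lambda> f"
    and src_src: "f \<in> mor \<Lambda> \<Longrightarrow> src \<Lambda> (src \<Lambda> f) = src \<Lambda> f"
    and cmp_closed: "\<lbrakk>f \<in> mor \<Lambda>; g \<in> mor \<Lambda>; src \<Lambda> f = rng \<Lambda> g\<rbrakk> \<Longrightarrow> cmp \<Lambda> f g \<in> mor \<Lambda>"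
    and rng_cmp: "\<lbrakk>f \<in> mor \<Lambda>; g \<in> mor \<Lambda>; src \<Lambda> f = rng \<Lambda> g\<rbrakk> \<Longrightarrow> rng \<Lambda> (cmp \<Lambda> f g) = rng \<Lambda> f"
    and src_cmp: "\<lbrakk>f \<in> mor \<Lambda>; g \<in> mor \<Lambda>; src \<Lambda> f = rng \<Lambda> g\<rbrakk> \<Longrightarrow> src \<Lambda> (cmp \<Lambda> f g) = src \<Lambda> g"
    and cmp_rng: "f \<in> mor \<Lambda> \<Longrightarrow> cmp \<Lambda> (rng \<Lambda> f) f = f"
    and cmp_src: "f \<in> mor \<Lambda> \<Longrightarrow> cmp \<Lambda> f (src \<Lambda> f) = f"
    and cmp_assoc: "\<lbrakk>f \<in> mor \<Lambda>; g \<in> mor \<Lambda>; h \<in> mor \<Lambda>; src \<Lambda> f = rng \<Lambda> g; src \<Lambda> g = rng \<Lambda> h\<rbrakk>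
      \<Longrightarrow> cmp \<Lambda> (cmp \<Lambda> f g) h = cmp \<Lambda> f (cmp \<Lambda> g h)"

locale kgraph = small_category \<Lambda>
  for k :: nat and \<Lambda> :: "('a, 'b) graph_data_scheme" +
  assumes countable_mor: "countable (mor \<Lambda>)"
    and deg_Nk: "f \<in> mor \<Lambda> \<Longrightarrow> deg \<Lambda> f \<in> Nk k"
    and deg_rng: "f \<in> mor \<Lambda> \<Longrightarrow> deg \<Lambda> (rng \<Lambda> f) = 0"
    and deg_src: "f \<in> mor \<Lambda> \<Longrightarrow> deg \<Lambda> (src \<Lambda> f) = 0"
    and deg_cmp: "\<lbrakk>f \<in> mor \<Lambda>; g \<in> mor \<Lambda>; src \<Lambda> f = rng \<Lambda> g\<rbrakk>
      \<Longrightarrow> deg \<Lambda> (cmp \<Lambda> f g) = deg \<Lambda> f + deg \<Lambda> g"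
    and factorisation: "\<lbrakk>f \<in> mor \<Lambda>; m \<in> Nk k; n \<in> Nk k; deg \<Lambda> f = m + n\<rbrakk>
      \<Longrightarrow> \<exists>!p. fst p \<in> mor \<Lambda> \<and> snd p \<in> mor \<Lambda> \<and> src \<Lambda> (fst p) = rng \<Lambda> (snd p) \<and>
               f = cmp \<Lambda> (fst p) (snd p) \<and> deg \<Lambda> (fst p) = m \<and> deg \<Lambda> (snd p) = n"

definition kgraph_morphism ::
    "('a, 'c) graph_data_scheme \<Rightarrow> ('b, 'd) graph_data_scheme \<Rightarrow> ('a \<Rightarrow> 'b) \<Rightarrow> bool"
  where "kgraph_morphism \<Gamma> \<Lambda> x \<longleftrightarrow>
    (\<forall>f\<in>mor \<Gamma>. x f \<in> mor \<Lambda> \<and> x (rng \<Gamma> f) = rng \<Lambda> (x f) \<and> x (src \<Gamma> f) = src \<Lambda> (x f)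
                 \<and> deg \<Lambda> (x f) = deg \<Gamma> f) \<and>
    (\<forall>f\<in>mor \<Gamma>. \<forall>g\<in>mor \<Gamma>. src \<Gamma> f = rng \<Gamma> g \<longrightarrow> x (cmp \<Gamma> f g) = cmp \<Lambda> (x f) (x g))"

text \<open>The object \<open>p\<close> of \<open>\<Omega>\<^bsub>k,m\<^esub>\<close> is represented by its identity morphism \<open>(p, p)\<close>.\<close>

definition Omega :: "nat \<Rightarrow> (nat \<Rightarrow> enat) \<Rightarrow> ((nat \<Rightarrow> nat) \<times> (nat \<Rightarrow> nat)) graph_data"
  where "Omega k m =
    \<lparr> mor = {(p, q). p \<in> Nk k \<and> q \<in> Nk k \<and> p \<le> q \<and> emb q \<le> m},
      rng = (\<lambda>(p, q). (p, p)),
      src = (\<lambda>(p, q). (q, q)),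
      cmp = (\<lambda>(p, q) (q', t). (p, t)),
      deg = (\<lambda>(p, q). q - p) \<rparr>"

text \<open>
  An element of the path space is a pair \<open>(m, x)\<close> consisting of its degree \<open>m\<close> and a \<open>k\<close>-graph
  morphism \<open>x\<close> on \<open>\<Omega>\<^bsub>k,m\<^esub>\<close>; extensionality makes \<open>x\<close> determined by its values on the morphisms of
  \<open>\<Omega>\<^bsub>k,m\<^esub>\<close>.
\<close>

definition path_space ::
    "nat \<Rightarrow> ('a, 'b) graph_data_scheme
      \<Rightarrow> ((nat \<Rightarrow> enat) \<times> ((nat \<Rightarrow> nat) \<times> (nat \<Rightarrow> nat) \<Rightarrow> 'a)) set"
  where "path_space k \<Lambda> =
    {(m, x). m \<in> Nk_inf k \<and> x \<in> extensional (mor (Omega k m)) \<and> kgraph_morphism (Omega k m) \<Lambda> x}"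

definition MCE :: "('a, 'b) graph_data_scheme \<Rightarrow> 'a \<Rightarrow> 'a \<Rightarrow> 'a set"
  where "MCE \<Lambda> \<mu> \<nu> = {f \<in> mor \<Lambda>.
    (\<exists>\<alpha>\<in>mor \<Lambda>. src \<Lambda> \<mu> = rng \<Lambda> \<alpha> \<and> f = cmp \<Lambda> \<mu> \<alpha>) \<and>
    (\<exists>\<beta>\<in>mor \<Lambda>. src \<Lambda> \<nu> = rng \<Lambda> \<beta> \<and> f = cmp \<Lambda> \<nu> \<beta>) \<and>
    deg \<Lambda> f = sup (deg \<Lambda> \<mu>) (deg \<Lambda> \<nu>)}"

definition finitely_aligned :: "('a, 'b) graph_data_scheme \<Rightarrow> bool"
  where "finitely_aligned \<Lambda> \<longleftrightarrow> (\<forall>\<mu>\<in>mor \<Lambda>. \<forall>\<nu>\<in>mor \<Lambda>. finite (MCE \<Lambda> \<mu> \<nu>))"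

definition cylinder ::
    "nat \<Rightarrow> ('a, 'b) graph_data_scheme \<Rightarrow> 'a
      \<Rightarrow> ((nat \<Rightarrow> enat) \<times> ((nat \<Rightarrow> nat) \<times> (nat \<Rightarrow> nat) \<Rightarrow> 'a)) set"
  where "cylinder k \<Lambda> \<mu> =
    {(m, x) \<in> path_space k \<Lambda>. emb (deg \<Lambda> \<mu>) \<le> m \<and> x (0, deg \<Lambda> \<mu>) = \<mu>}"

definition cylinder_diff ::
    "nat \<Rightarrow> ('a, 'b) graph_data_scheme \<Rightarrow> 'a \<Rightarrow> 'a set
      \<Rightarrow> ((nat \<Rightarrow> enat) \<times> ((nat \<Rightarrow> nat) \<times> (nat \<Rightarrow> nat) \<Rightarrow> 'a)) set"
  where "cylinder_diff k \<Lambda> \<mu> G = cylinder k \<Lambda> \<mu> - (\<Union>\<nu>\<in>G. cylinder k \<Lambda> (cmp \<Lambda> \<mu> \<nu>))"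

definition edges_from :: "('a, 'b) graph_data_scheme \<Rightarrow> 'a \<Rightarrow> nat \<Rightarrow> 'a set"
  where "edges_from \<Lambda> v i = {f \<in> mor \<Lambda>. deg \<Lambda> f = unit_deg i \<and> rng \<Lambda> f = v}"

definition alpha ::
    "nat \<Rightarrow> ('a, 'b) graph_data_scheme
      \<Rightarrow> (nat \<Rightarrow> enat) \<times> ((nat \<Rightarrow> nat) \<times> (nat \<Rightarrow> nat) \<Rightarrow> 'a) \<Rightarrow> 'a \<Rightarrow> nat"
  where "alpha k \<Lambda> w = (\<lambda>y\<in>mor \<Lambda>. if w \<in> cylinder k \<Lambda> y then 1 else 0)"

definition topology_base :: "'a topology \<Rightarrow> 'a set set \<Rightarrow> bool"
  where "topology_base X B \<longleftrightarrow>
    (\<forall>U\<in>B. openin X U) \<and> (\<forall>U. openin X U \<longrightarrow> (\<exists>B'. B' \<subseteq> B \<and> \<Union>B' = U))"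

end

theory Submission
  imports Defs
begin

text \<open>
  A basic neighbourhood of \<open>w\<close> in the initial topology fixes membership in the cylinders of finitely
  many paths \<open>y \<in> F\<close>.  Choose a finite degree \<open>p \<le> d(w)\<close> above every \<open>d(y) \<and> d(w)\<close> and put
  \<open>\<lambda> = w(0,p)\<close>.  If \<open>d(y) \<le> d(w)\<close>, then \<open>\<lambda>\<close> already decides membership in \<open>\<Z>(y)\<close>.  Otherwise
  \<open>p\<^sub>i = d(w)\<^sub>i < d(y)\<^sub>i\<close> for some \<open>i\<close>, so each path in \<open>\<Z>(\<lambda>) \<inter> \<Z>(y)\<close> passes through an edge of degree
  \<open>e\<^sub>i\<close> after \<open>\<lambda>\<close>; as this edge is read off from an element of \<open>MCE(\<lambda>, y)\<close>, finite alignment leaves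
  only finitely many such edges to be removed.
\<close>

section \<open>Finite degrees and truncation by a possibly infinite degree\<close>

lemma emb_le_iff [simp]: "emb p \<le> emb q \<longleftrightarrow> p \<le> q"
  by (auto simp: emb_def le_fun_def)

lemma Nk_downward: "p \<le> q \<Longrightarrow> q \<in> Nk k \<Longrightarrow> p \<in> Nk k"
  unfolding Nk_def le_fun_def mem_Collect_eq using le_0_eq by metis

lemma Nk_sup: "p \<in> Nk k \<Longrightarrow> q \<in> Nk k \<Longrightarrow> sup p q \<in> Nk k"
  by (auto simp: Nk_def sup_fun_def)

lemma zero_Nk: "0 \<in> Nk k"
  by (auto simp: Nk_def)

lemma zero_le_deg: "(0 :: nat \<Rightarrow> nat) \<le> p"
  by (auto simp: le_fun_def)

lemma emb_sup_le: "emb p \<le> m \<Longrightarrow> emb q \<le> m \<Longrightarrow> emb (sup p q) \<le> m"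
  by (auto simp: emb_def le_fun_def sup_fun_def sup_nat_def max_def)

lemma emb_le_mono: "p \<le> q \<Longrightarrow> emb q \<le> m \<Longrightarrow> emb p \<le> m"
  using order_trans emb_le_iff by blast

text \<open>Truncating a finite degree by \<open>m\<close> gives a finite degree again, even where
  \<open>m\<close> is infinite, and a join of finitely many such truncations stays below
  \<open>m\<close>.\<close>

lemma finite_truncation_bound:
  assumes "finite A" "A \<subseteq> Nk k"
  shows "\<exists>p\<in>Nk k. emb p \<le> m \<and> (\<forall>n\<in>A. inf (emb n) m \<le> emb p)"
  using assms
proof (induction A rule: finite_induct)
  case empty
  have "emb 0 \<le> m"
    by (auto simp: emb_def le_fun_def zero_enat_def[symmetric])
  then show ?case
    using zero_Nk by blast
next
  case (insert n A)
  then obtain p where p: "p \<in> Nk k" "emb p \<le> m" "\<forall>n\<in>A. inf (emb n) m \<le> emb p"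
    by blast
  \<comment> \<open>The minimum is bounded by the finite value \<open>n i\<close>, so
    \<open>the_enat\<close> never meets infinity here.\<close>
  define t where "t = (\<lambda>i. the_enat (min (enat (n i)) (m i)))"
  have t: "emb t = inf (emb n) m"
    unfolding emb_def t_def inf_fun_def inf_enat_def
    by (rule ext, case_tac "m i") (simp_all add: min_def)
  have "t \<le> n"
    using t by (metis emb_le_iff inf.cobounded1)
  then have "t \<in> Nk k"
    using Nk_downward insert.prems by blast
  moreover have "emb (sup p t) \<le> m"
    using p t by (intro emb_sup_le) auto
  moreover have "inf (emb n') m \<le> emb (sup p t)" if "n' \<in> insert n A" for n'
  proof -
    have "emb p \<le> emb (sup p t)" "emb t \<le> emb (sup p t)"
      by simp_all
    then show ?thesis
      using that p(3) t by (metis insertE order_trans)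
  qed
  ultimately show ?case
    using Nk_sup p(1) by blast
qed

section \<open>Cancellation and segments of paths\<close>

context kgraph
begin

text \<open>Additivity of the degree makes the second factors agree in degree too. Both pairs are
  then factorisations of one morphism with the same degrees, and unique factorisation
  applies.\<close>

lemma cmp_cancel:
  assumes "f \<in> mor \<Lambda>" "g \<in> mor \<Lambda>" "src \<Lambda> f = rng \<Lambda> g"
    and "f' \<in> mor \<Lambda>" "g' \<in> mor \<Lambda>" "src \<Lambda> f' = rng \<Lambda> g'"
    and eq: "cmp \<Lambda> f g = cmp \<Lambda> f' g'" and deg: "deg \<Lambda> f = deg \<Lambda> f'"
  shows "f = f' \<and> g = g'"
proof -
  have "deg \<Lambda> f + deg \<Lambda> g = deg \<Lambda> f' + deg \<Lambda> g'"
    using assms deg_cmp by metis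
  then have deg': "deg \<Lambda> g = deg \<Lambda> g'"
    using deg by simp
  have "cmp \<Lambda> f g \<in> mor \<Lambda>" "deg \<Lambda> (cmp \<Lambda> f g) = deg \<Lambda> f + deg \<Lambda> g"
    using assms(1-3) cmp_closed deg_cmp by blast+
  from factorisation[OF this(1) deg_Nk deg_Nk this(2)]
  have "\<exists>!p. fst p \<in> mor \<Lambda> \<and> snd p \<in> mor \<Lambda> \<and> src \<Lambda> (fst p) = rng \<Lambda> (snd p) \<and>
      cmp \<Lambda> f g = cmp \<Lambda> (fst p) (snd p) \<and> deg \<Lambda> (fst p) = deg \<Lambda> f \<and> deg \<Lambda> (snd p) = deg \<Lambda> g"
    (is "\<exists>!p. ?P p")
    using assms by blast
  moreover have "?P (f, g)" "?P (f', g')"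
    using assms deg' by simp_all
  ultimately have "(f, g) = (f', g')"
    by blast
  then show ?thesis
    by simp
qed

lemma path_segment:
  assumes "(m, x) \<in> path_space k \<Lambda>" "p \<le> q" "q \<in> Nk k" "emb q \<le> m"
  shows "x (p, q) \<in> mor \<Lambda>" "rng \<Lambda> (x (p, q)) = x (p, p)" "src \<Lambda> (x (p, q)) = x (q, q)"
    "deg \<Lambda> (x (p, q)) = q - p"
proof -
  have "(p, q) \<in> mor (Omega k m)"
    using assms Nk_downward by (auto simp: Omega_def)
  moreover have "kgraph_morphism (Omega k m) \<Lambda> x"
    using assms(1) by (auto simp: path_space_def)
  ultimately have "x (p, q) \<in> mor \<Lambda> \<and> x (rng (Omega k m) (p, q)) = rng \<Lambda> (x (p, q))
      \<and> x (src (Omega k m) (p, q)) = src \<Lambda> (x (p, q)) \<and> deg \<Lambda> (x (p, q)) = deg (Omega k m) (p, q)"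
    unfolding kgraph_morphism_def by blast
  then show "x (p, q) \<in> mor \<Lambda>" "rng \<Lambda> (x (p, q)) = x (p, p)" "src \<Lambda> (x (p, q)) = x (q, q)"
    "deg \<Lambda> (x (p, q)) = q - p"
    by (auto simp: Omega_def)
qed

lemma path_segment_cmp:
  assumes "(m, x) \<in> path_space k \<Lambda>" "p \<le> q" "q \<le> t" "t \<in> Nk k" "emb t \<le> m"
  shows "x (p, t) = cmp \<Lambda> (x (p, q)) (x (q, t))" "src \<Lambda> (x (p, q)) = rng \<Lambda> (x (q, t))"
proof -
  have q: "q \<in> Nk k" "emb q \<le> m"
    using assms Nk_downward emb_le_mono by blast+
  have "(p, q) \<in> mor (Omega k m)" "(q, t) \<in> mor (Omega k m)"
    using assms q Nk_downward by (auto simp: Omega_def)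
  moreover have "src (Omega k m) (p, q) = rng (Omega k m) (q, t)"
    by (simp add: Omega_def)
  moreover have "kgraph_morphism (Omega k m) \<Lambda> x"
    using assms(1) by (auto simp: path_space_def)
  ultimately have "x (cmp (Omega k m) (p, q) (q, t)) = cmp \<Lambda> (x (p, q)) (x (q, t))"
    unfolding kgraph_morphism_def by blast
  then show "x (p, t) = cmp \<Lambda> (x (p, q)) (x (q, t))"
    by (simp add: Omega_def)
  show "src \<Lambda> (x (p, q)) = rng \<Lambda> (x (q, t))"
    using assms q by (simp add: path_segment)
qed

text \<open>Splitting the common prefix at \<open>q\<close> along either path factorises one
  morphism with the same degrees, so cancellation identifies the initial pieces.\<close>

lemma path_prefix_eq_mono:
  assumes w: "(m, w) \<in> path_space k \<Lambda>" and x: "(l, x) \<in> path_space k \<Lambda>"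
    and p: "p \<in> Nk k" "emb p \<le> m" "emb p \<le> l" and eq: "x (0, p) = w (0, p)" and "q \<le> p"
  shows "x (0, q) = w (0, q)"
proof -
  have q: "q \<in> Nk k" "emb q \<le> m" "emb q \<le> l"
    using assms Nk_downward emb_le_mono by blast+
  note W = path_segment_cmp[OF w zero_le_deg \<open>q \<le> p\<close> p(1,2)]
    and X = path_segment_cmp[OF x zero_le_deg \<open>q \<le> p\<close> p(1,3)]
  have "x (0, q) = w (0, q) \<and> x (q, p) = w (q, p)"
    using W X eq p q \<open>q \<le> p\<close>
    by (intro cmp_cancel) (simp_all add: path_segment[OF w] path_segment[OF x] zero_le_deg)
  then show ?thesis ..
qed

section \<open>Common extensions and the edges that lead to them\<close>

text \<open>The degree of \<open>x\<close> dominates both degrees and hence their join. The prefix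
  up to the join splits at the degree of \<mu> and also at that of \<nu>.\<close>

lemma path_prefix_MCE:
  assumes x: "(l, x) \<in> cylinder k \<Lambda> \<mu>" "(l, x) \<in> cylinder k \<Lambda> \<nu>"
    and "\<mu> \<in> mor \<Lambda>" "\<nu> \<in> mor \<Lambda>"
  shows "x (0, sup (deg \<Lambda> \<mu>) (deg \<Lambda> \<nu>)) \<in> MCE \<Lambda> \<mu> \<nu>"
proof -
  let ?s = "sup (deg \<Lambda> \<mu>) (deg \<Lambda> \<nu>)"
  have W: "(l, x) \<in> path_space k \<Lambda>"
    and c: "emb (deg \<Lambda> \<mu>) \<le> l" "emb (deg \<Lambda> \<nu>) \<le> l" "x (0, deg \<Lambda> \<mu>) = \<mu>" "x (0, deg \<Lambda> \<nu>) = \<nu>"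
    using x by (auto simp: cylinder_def)
  have s: "?s \<in> Nk k" "emb ?s \<le> l"
    using c assms deg_Nk Nk_sup emb_sup_le by auto
  note seg = path_segment[OF W _ s]
  have "x (0, ?s) \<in> mor \<Lambda>" "deg \<Lambda> (x (0, ?s)) = ?s"
    using seg[OF zero_le_deg] by simp_all
  moreover have "x (deg \<Lambda> \<mu>, ?s) \<in> mor \<Lambda>" "x (deg \<Lambda> \<nu>, ?s) \<in> mor \<Lambda>"
    using seg by simp_all
  moreover have "src \<Lambda> \<mu> = rng \<Lambda> (x (deg \<Lambda> \<mu>, ?s))" "x (0, ?s) = cmp \<Lambda> \<mu> (x (deg \<Lambda> \<mu>, ?s))"
    using path_segment_cmp[OF W zero_le_deg sup_ge1 s] c by auto
  moreover have "src \<Lambda> \<nu> = rng \<Lambda> (x (deg \<Lambda> \<nu>, ?s))" "x (0, ?s) = cmp \<Lambda> \<nu> (x (deg \<Lambda> \<nu>, ?s))"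
    using path_segment_cmp[OF W zero_le_deg sup_ge2 s] c by auto
  ultimately show ?thesis
    unfolding MCE_def by blast
qed

text \<open>By unique factorisation an edge following \<open>\<mu>\<close> is determined by its degree and an extension.\<close>

lemma finite_next_edges:
  assumes "\<mu> \<in> mor \<Lambda>" "finite E"
  shows "finite {e \<in> (\<Union>i<k. edges_from \<Lambda> (src \<Lambda> \<mu>) i).
    \<exists>\<beta>\<in>mor \<Lambda>. src \<Lambda> e = rng \<Lambda> \<beta> \<and> cmp \<Lambda> (cmp \<Lambda> \<mu> e) \<beta> \<in> E}"
proof -
  define S where "S f i = {e \<in> edges_from \<Lambda> (src \<Lambda> \<mu>) i.
    \<exists>\<beta>\<in>mor \<Lambda>. src \<Lambda> e = rng \<Lambda> \<beta> \<and> cmp \<Lambda> (cmp \<Lambda> \<mu> e) \<beta> = f}" for f i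
  have "e = e'" if S: "e \<in> S f i" "e' \<in> S f i" for e e' f i
  proof -
    have e: "e \<in> mor \<Lambda>" "deg \<Lambda> e = unit_deg i" "src \<Lambda> \<mu> = rng \<Lambda> e"
      and e': "e' \<in> mor \<Lambda>" "deg \<Lambda> e' = unit_deg i" "src \<Lambda> \<mu> = rng \<Lambda> e'"
      using S by (simp_all add: S_def edges_from_def)
    obtain \<beta> \<beta>' where b: "\<beta> \<in> mor \<Lambda>" "src \<Lambda> e = rng \<Lambda> \<beta>" "cmp \<Lambda> (cmp \<Lambda> \<mu> e) \<beta> = f"
      and b': "\<beta>' \<in> mor \<Lambda>" "src \<Lambda> e' = rng \<Lambda> \<beta>'" "cmp \<Lambda> (cmp \<Lambda> \<mu> e') \<beta>' = f"
      using S unfolding S_def by blast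
    \<comment> \<open>Both composites have degree \<open>deg \<Lambda> \<mu> + unit_deg i\<close>,
      so the tails can be cancelled first; a second cancellation then removes \<mu>.\<close>
    have "cmp \<Lambda> \<mu> e = cmp \<Lambda> \<mu> e' \<and> \<beta> = \<beta>'"
      using e e' b b' assms by (intro cmp_cancel) (auto simp: cmp_closed src_cmp deg_cmp)
    then show ?thesis
      using cmp_cancel e e' assms by blast
  qed
  then have "\<exists>e. S f i \<subseteq> {e}" for f i
    by (cases "S f i = {}") blast+
  then have "finite (S f i)" for f i
    by (metis finite.emptyI finite.insertI finite_subset)
  then have "finite (\<Union>f\<in>E. \<Union>i<k. S f i)"
    using assms(2) by blast
  then show ?thesis
    by (rule finite_subset[rotated]) (auto simp: S_def)
qed

text \<open>Since \<nu> reaches further than \<mu> in direction \<open>i\<close>, one unit step from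
  the degree of \<mu> stays below the join of the degrees. That step along \<open>x\<close> is the
  edge \<open>e\<close>, and the remaining segment up to the join is \<beta>.\<close>

lemma cylinder_next_edge:
  assumes x: "(l, x) \<in> cylinder k \<Lambda> \<mu>" "(l, x) \<in> cylinder k \<Lambda> \<nu>"
    and mor: "\<mu> \<in> mor \<Lambda>" "\<nu> \<in> mor \<Lambda>" and i: "deg \<Lambda> \<mu> i < deg \<Lambda> \<nu> i"
  obtains e \<beta> where "i < k" "e \<in> edges_from \<Lambda> (src \<Lambda> \<mu>) i" "\<beta> \<in> mor \<Lambda>" "src \<Lambda> e = rng \<Lambda> \<beta>"
    "cmp \<Lambda> (cmp \<Lambda> \<mu> e) \<beta> \<in> MCE \<Lambda> \<mu> \<nu>" "(l, x) \<in> cylinder k \<Lambda> (cmp \<Lambda> \<mu> e)"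
proof -
  let ?p = "deg \<Lambda> \<mu>" and ?s = "sup (deg \<Lambda> \<mu>) (deg \<Lambda> \<nu>)" and ?q = "deg \<Lambda> \<mu> + unit_deg i"
  have W: "(l, x) \<in> path_space k \<Lambda>"
    and c: "emb ?p \<le> l" "emb (deg \<Lambda> \<nu>) \<le> l" "x (0, ?p) = \<mu>"
    using x by (auto simp: cylinder_def)
  have s: "?s \<in> Nk k" "emb ?s \<le> l"
    using c mor deg_Nk Nk_sup emb_sup_le by auto
  \<comment> \<open>The degree of \<nu> is positive at \<open>i\<close> but vanishes from index
    \<open>k\<close> on.\<close>
  have "i < k"
    using i deg_Nk[OF mor(2)] unfolding Nk_def mem_Collect_eq by (metis not_le less_zeroE)
  have qs: "?q \<le> ?s" and pq: "?p \<le> ?q"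
    using i by (auto simp: le_fun_def sup_fun_def sup_nat_def unit_deg_def less_eq_Suc_le)
  have q: "?q \<in> Nk k" "emb ?q \<le> l"
    using Nk_downward emb_le_mono qs s by blast+
  note e = path_segment[OF W pq q] path_segment_cmp[OF W zero_le_deg pq q]
    and b = path_segment[OF W qs s] path_segment_cmp[OF W zero_le_deg qs s]
  show ?thesis
  proof (rule that)
    show "i < k" by fact
    show "x (?p, ?q) \<in> edges_from \<Lambda> (src \<Lambda> \<mu>) i"
      using e c by (simp add: edges_from_def)
    show "x (?q, ?s) \<in> mor \<Lambda>"
      using b by simp
    show "src \<Lambda> (x (?p, ?q)) = rng \<Lambda> (x (?q, ?s))"
      using e b by simp
    show "cmp \<Lambda> (cmp \<Lambda> \<mu> (x (?p, ?q))) (x (?q, ?s)) \<in> MCE \<Lambda> \<mu> \<nu>"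
      using path_prefix_MCE[OF x mor] e(5) b(5) c(3) by simp
    show "(l, x) \<in> cylinder k \<Lambda> (cmp \<Lambda> \<mu> (x (?p, ?q)))"
      using W q e c mor by (simp add: cylinder_def deg_cmp)
  qed
qed

section \<open>Neighbourhoods deciding membership in finitely many cylinders\<close>

lemma cylinder_diff_neighbourhood:
  assumes fa: "finitely_aligned \<Lambda>" and W: "w \<in> path_space k \<Lambda>"
    and F: "finite F" "F \<subseteq> mor \<Lambda>"
  obtains \<mu> G where "\<mu> \<in> mor \<Lambda>" "finite G" "G \<subseteq> (\<Union>i<k. edges_from \<Lambda> (src \<Lambda> \<mu>) i)"
    "w \<in> cylinder_diff k \<Lambda> \<mu> G"
    "\<And>v y. v \<in> cylinder_diff k \<Lambda> \<mu> G \<Longrightarrow> y \<in> F \<Longrightarrow> v \<in> cylinder k \<Lambda> y \<longleftrightarrow> w \<in> cylinder k \<Lambda> y"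
proof -
  obtain m x where w: "w = (m, x)"
    by (cases w)
  note Wx = W[unfolded w]
  have "finite (deg \<Lambda> ` F)" "deg \<Lambda> ` F \<subseteq> Nk k"
    using F deg_Nk by auto
  from finite_truncation_bound[OF this, of m] obtain p
    where p: "p \<in> Nk k" "emb p \<le> m" and F_le: "\<And>y. y \<in> F \<Longrightarrow> inf (emb (deg \<Lambda> y)) m \<le> emb p"
    by auto
  define \<mu> where "\<mu> = x (0, p)"
  have \<mu>: "\<mu> \<in> mor \<Lambda>" "deg \<Lambda> \<mu> = p"
    using path_segment[OF Wx zero_le_deg p] by (auto simp: \<mu>_def)
  have w\<mu>: "w \<in> cylinder k \<Lambda> \<mu>"
    using W p \<mu> by (auto simp: w cylinder_def \<mu>_def[symmetric])
  \<comment> \<open>Excluding the edges that \<open>w\<close> itself follows keeps \<open>w\<close>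
    in the difference; requiring an extension in some \<open>MCE \<Lambda> \<mu> y\<close> makes the
    set finite.\<close>
  define G where "G = {e \<in> (\<Union>i<k. edges_from \<Lambda> (src \<Lambda> \<mu>) i). w \<notin> cylinder k \<Lambda> (cmp \<Lambda> \<mu> e) \<and>
    (\<exists>\<beta>\<in>mor \<Lambda>. src \<Lambda> e = rng \<Lambda> \<beta> \<and> cmp \<Lambda> (cmp \<Lambda> \<mu> e) \<beta> \<in> (\<Union>y\<in>F. MCE \<Lambda> \<mu> y))}"
  have "finite (\<Union>y\<in>F. MCE \<Lambda> \<mu> y)"
    using fa F \<mu> unfolding finitely_aligned_def by auto
  from finite_next_edges[OF \<mu>(1) this] have "finite G"
    by (rule finite_subset[rotated]) (auto simp: G_def)
  moreover have "w \<in> cylinder_diff k \<Lambda> \<mu> G"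
    using w\<mu> by (auto simp: cylinder_diff_def G_def)
  moreover have "v \<in> cylinder k \<Lambda> y \<longleftrightarrow> w \<in> cylinder k \<Lambda> y"
    if v: "v \<in> cylinder_diff k \<Lambda> \<mu> G" and y: "y \<in> F" for v y
  proof -
    obtain l z where vz: "v = (l, z)"
      by (cases v)
    have Z: "(l, z) \<in> path_space k \<Lambda>" "emb p \<le> l" "z (0, p) = x (0, p)"
      and v\<mu>: "v \<in> cylinder k \<Lambda> \<mu>"
      using v \<mu> by (auto simp: vz cylinder_diff_def cylinder_def \<mu>_def)
    show ?thesis
    proof (cases "emb (deg \<Lambda> y) \<le> m")
      case True
      \<comment> \<open>Here truncation by \<open>m\<close> leaves the degree of \<open>y\<close>
        unchanged, so it lies below \<open>p\<close>, up to which \<open>v\<close> and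
        \<open>w\<close> agree.\<close>
      then have le: "deg \<Lambda> y \<le> p"
        using F_le[OF y] by (metis emb_le_iff inf.absorb1)
      then show ?thesis
        using path_prefix_eq_mono[OF Wx Z(1) p Z(2,3) le] emb_le_mono[OF le] Z p Wx
        by (auto simp: w vz cylinder_def)
    next
      case False
      then obtain i where i: "m i < enat (deg \<Lambda> y i)"
        by (auto simp: emb_def le_fun_def not_le)
      have "inf (emb (deg \<Lambda> y)) m i \<le> emb p i"
        using F_le[OF y] by (rule le_funD)
      \<comment> \<open>At \<open>i\<close> the truncation is \<open>m i\<close> itself, so
        \<open>p i\<close> is at least \<open>m i\<close>; the reverse bound comes from
        \<open>emb p \<le> m\<close>.\<close>
      then have mi: "m i = enat (p i)"
        using i le_funD[OF p(2), of i] by (auto simp: emb_def inf_enat_def min_def split: if_splits)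
      have "v \<notin> cylinder k \<Lambda> y"
      proof
        assume vy: "v \<in> cylinder k \<Lambda> y"
        have "y \<in> mor \<Lambda>" "deg \<Lambda> \<mu> i < deg \<Lambda> y i"
          using y F i mi \<mu> by auto
        then obtain e \<beta> where e: "i < k" "e \<in> edges_from \<Lambda> (src \<Lambda> \<mu>) i" "\<beta> \<in> mor \<Lambda>"
          "src \<Lambda> e = rng \<Lambda> \<beta>" "cmp \<Lambda> (cmp \<Lambda> \<mu> e) \<beta> \<in> MCE \<Lambda> \<mu> y"
          and ve: "v \<in> cylinder k \<Lambda> (cmp \<Lambda> \<mu> e)"
          using cylinder_next_edge v\<mu> vy \<mu>(1) unfolding vz by metis
        \<comment> \<open>One step beyond \<open>p i = m i\<close> already exceeds the degree of
          \<open>w\<close>, so \<open>w\<close> cannot follow \<open>e\<close>, and \<open>e\<close>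
          is among the removed edges.\<close>
        have "deg \<Lambda> (cmp \<Lambda> \<mu> e) i = Suc (p i)"
          using e(2) \<mu> by (auto simp: edges_from_def deg_cmp unit_deg_def)
        then have "\<not> emb (deg \<Lambda> (cmp \<Lambda> \<mu> e)) \<le> m"
          using mi by (auto simp: emb_def le_fun_def intro!: exI[of _ i])
        then have "w \<notin> cylinder k \<Lambda> (cmp \<Lambda> \<mu> e)"
          by (auto simp: w cylinder_def)
        then have "e \<in> G"
          using e y unfolding G_def by blast
        then show False
          using ve v by (auto simp: cylinder_diff_def)
      qed
      then show ?thesis
        using False by (auto simp: w cylinder_def)
    qed
  qed
  moreover have "G \<subseteq> (\<Union>i<k. edges_from \<Lambda> (src \<Lambda> \<mu>) i)"
    by (auto simp: G_def)
  ultimately show ?thesis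
    by (intro that[of \<mu> G] \<mu>(1))
qed

end

section \<open>The topology induced by \<open>alpha\<close>\<close>

text \<open>For a single map the initial topology is the pullback: its open sets are the preimages
  in the path space of open sets of the product.\<close>

abbreviation initial_topology ::
    "nat \<Rightarrow> ('a, 'b) graph_data_scheme
      \<Rightarrow> ((nat \<Rightarrow> enat) \<times> ((nat \<Rightarrow> nat) \<times> (nat \<Rightarrow> nat) \<Rightarrow> 'a)) topology"
  where "initial_topology k \<Lambda> \<equiv> pullback_topology (path_space k \<Lambda>) (alpha k \<Lambda>)
    (product_topology (\<lambda>_. discrete_topology {0, 1}) (mor \<Lambda>))"

text \<open>The projection to coordinate \<open>y\<close> is continuous into a discrete space, and
  \<open>alpha\<close> maps every path into the product, so restricting to the product's points
  loses nothing.\<close>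

lemma openin_cylinder_cases:
  assumes "y \<in> mor \<Lambda>" "A \<subseteq> {0, 1}"
  shows "openin (initial_topology k \<Lambda>) {w \<in> path_space k \<Lambda>. alpha k \<Lambda> w y \<in> A}"
proof -
  let ?P = "product_topology (\<lambda>_. discrete_topology {0, 1 :: nat}) (mor \<Lambda>)"
  have "openin ?P {f \<in> topspace ?P. f y \<in> A}"
    by (rule openin_continuous_map_preimage[OF continuous_map_product_projection])
      (use assms in auto)
  moreover have "{w \<in> path_space k \<Lambda>. alpha k \<Lambda> w y \<in> A}
      = alpha k \<Lambda> -` {f \<in> topspace ?P. f y \<in> A} \<inter> path_space k \<Lambda>"
    by (auto simp: alpha_def PiE_def)
  ultimately show ?thesis
    unfolding openin_pullback_topology by blast
qed

lemma openin_cylinder: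
  assumes "y \<in> mor \<Lambda>"
  shows "openin (initial_topology k \<Lambda>) (cylinder k \<Lambda> y)"
    and "openin (initial_topology k \<Lambda>) (path_space k \<Lambda> - cylinder k \<Lambda> y)"
proof -
  have sub: "cylinder k \<Lambda> y \<subseteq> path_space k \<Lambda>"
    by (auto simp: cylinder_def)
  have "cylinder k \<Lambda> y = {w \<in> path_space k \<Lambda>. alpha k \<Lambda> w y \<in> {1}}"
    "path_space k \<Lambda> - cylinder k \<Lambda> y = {w \<in> path_space k \<Lambda>. alpha k \<Lambda> w y \<in> {0}}"
    using assms sub by (auto simp: alpha_def split: if_splits)
  then show "openin (initial_topology k \<Lambda>) (cylinder k \<Lambda> y)"
    "openin (initial_topology k \<Lambda>) (path_space k \<Lambda> - cylinder k \<Lambda> y)"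
    using openin_cylinder_cases[OF assms, of "{1}" k] openin_cylinder_cases[OF assms, of "{0}" k]
    by simp_all
qed

lemma openin_cylinder_diff:
  assumes "\<mu> \<in> mor \<Lambda>" "finite G" "\<And>\<nu>. \<nu> \<in> G \<Longrightarrow> cmp \<Lambda> \<mu> \<nu> \<in> mor \<Lambda>"
  shows "openin (initial_topology k \<Lambda>) (cylinder_diff k \<Lambda> \<mu> G)"
proof -
  \<comment> \<open>A finite intersection of clopen sets; the member
    \<open>cylinder k \<Lambda> \<mu>\<close> keeps the family nonempty when \<open>G\<close> is
    empty.\<close>
  have "cylinder_diff k \<Lambda> \<mu> G =
      \<Inter>(insert (cylinder k \<Lambda> \<mu>) ((\<lambda>\<nu>. path_space k \<Lambda> - cylinder k \<Lambda> (cmp \<Lambda> \<mu> \<nu>)) ` G))"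
    by (auto simp: cylinder_diff_def cylinder_def)
  also have "openin (initial_topology k \<Lambda>) \<dots>"
  proof (rule openin_Inter)
    fix C
    assume "C \<in> insert (cylinder k \<Lambda> \<mu>)
      ((\<lambda>\<nu>. path_space k \<Lambda> - cylinder k \<Lambda> (cmp \<Lambda> \<mu> \<nu>)) ` G)"
    then show "openin (initial_topology k \<Lambda>) C"
      using openin_cylinder(1)[OF assms(1), of k] openin_cylinder(2)[OF assms(3), of _ k] by auto
  qed (use assms(2) in auto)
  finally show ?thesis .
qed

text \<open>A basic box of the product topology constrains only finitely many coordinates; these
  form \<open>F\<close>.\<close>

lemma initial_topology_neighbourhood:
  assumes "openin (initial_topology k \<Lambda>) U" "w \<in> U"
  obtains F where "finite F" "F \<subseteq> mor \<Lambda>"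
    "\<And>v. v \<in> path_space k \<Lambda> \<Longrightarrow> (\<And>y. y \<in> F \<Longrightarrow> v \<in> cylinder k \<Lambda> y \<longleftrightarrow> w \<in> cylinder k \<Lambda> y) \<Longrightarrow> v \<in> U"
proof -
  obtain V where V: "openin (product_topology (\<lambda>_. discrete_topology {0, 1 :: nat}) (mor \<Lambda>)) V"
    and U: "U = alpha k \<Lambda> -` V \<inter> path_space k \<Lambda>"
    using assms(1) unfolding openin_pullback_topology by blast
  have "alpha k \<Lambda> w \<in> V"
    using U assms(2) by auto
  with V obtain B where B: "finite {y \<in> mor \<Lambda>. B y \<noteq> {0, 1 :: nat}}"
    "alpha k \<Lambda> w \<in> Pi\<^sub>E (mor \<Lambda>) B" "Pi\<^sub>E (mor \<Lambda>) B \<subseteq> V"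
    unfolding openin_product_topology_alt by force
  show ?thesis
  proof (rule that[OF B(1)])
    fix v
    assume v: "v \<in> path_space k \<Lambda>"
      and eq: "\<And>y. y \<in> {y \<in> mor \<Lambda>. B y \<noteq> {0, 1}} \<Longrightarrow> v \<in> cylinder k \<Lambda> y \<longleftrightarrow> w \<in> cylinder k \<Lambda> y"
    have "alpha k \<Lambda> v y \<in> B y" if "y \<in> mor \<Lambda>" for y
    proof (cases "B y = {0, 1}")
      \<comment> \<open>An unconstrained coordinate imposes nothing, as \<open>alpha\<close> takes
        only the values 0 and 1.\<close>
      case True
      then show ?thesis
        using that by (auto simp: alpha_def)
    next
      case False
      then have "alpha k \<Lambda> v y = alpha k \<Lambda> w y"
        using that eq by (auto simp: alpha_def)
      then show ?thesis
        using B(2) that by (auto simp: PiE_iff)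
    qed
    then have "alpha k \<Lambda> v \<in> Pi\<^sub>E (mor \<Lambda>) B"
      by (auto simp: PiE_iff alpha_def)
    then show "v \<in> U"
      using B(3) U v by auto
  qed auto
qed

text \<open>An open set is the union of all members of \<open>B\<close> that it contains.\<close>

lemma topology_baseI:
  assumes "\<And>U. U \<in> B \<Longrightarrow> openin X U"
    and "\<And>U w. openin X U \<Longrightarrow> w \<in> U \<Longrightarrow> \<exists>b\<in>B. w \<in> b \<and> b \<subseteq> U"
  shows "topology_base X B"
  unfolding topology_base_def
proof (intro conjI ballI allI impI)
  fix U
  assume "openin X U"
  then have "\<Union>{b \<in> B. b \<subseteq> U} = U"
    using assms(2) by blast
  moreover have "{b \<in> B. b \<subseteq> U} \<subseteq> B"
    by blast
  ultimately show "\<exists>B'\<subseteq>B. \<Union>B' = U"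
    by metis
qed (rule assms(1))

theorem theorem3p1:
  fixes k :: nat and \<Lambda> :: "'a graph_data"
  assumes "kgraph k \<Lambda>" and "finitely_aligned \<Lambda>"
  shows "topology_base
    (pullback_topology (path_space k \<Lambda>) (alpha k \<Lambda>)
      (product_topology (\<lambda>_. discrete_topology {0, 1}) (mor \<Lambda>)))
    {cylinder_diff k \<Lambda> \<mu> G | \<mu> G.
      \<mu> \<in> mor \<Lambda> \<and> finite G \<and> G \<subseteq> (\<Union>i<k. edges_from \<Lambda> (src \<Lambda> \<mu>) i)}"
    (is "topology_base ?T ?B")
proof -
  interpret kgraph k \<Lambda>
    by fact
  show ?thesis
  proof (rule topology_baseI)
    fix U
    assume "U \<in> ?B"
    then obtain \<mu> G where U: "U = cylinder_diff k \<Lambda> \<mu> G"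
      and \<mu>G: "\<mu> \<in> mor \<Lambda>" "finite G" "G \<subseteq> (\<Union>i<k. edges_from \<Lambda> (src \<Lambda> \<mu>) i)"
      by blast
    \<comment> \<open>Edges in \<open>G\<close> start where \<mu> ends, so each removed cylinder
      belongs to a genuine path and hence to a coordinate of \<open>alpha\<close>.\<close>
    have "cmp \<Lambda> \<mu> \<nu> \<in> mor \<Lambda>" if "\<nu> \<in> G" for \<nu>
    proof -
      have "\<nu> \<in> mor \<Lambda>" "rng \<Lambda> \<nu> = src \<Lambda> \<mu>"
        using that \<mu>G(3) by (auto simp: edges_from_def)
      then show ?thesis
        using \<mu>G(1) cmp_closed by auto
    qed
    then show "openin ?T U"
      unfolding U by (rule openin_cylinder_diff[OF \<mu>G(1,2)])
  next
    fix U w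
    assume U: "openin ?T U" and wU: "w \<in> U"
    have w: "w \<in> path_space k \<Lambda>"
      using U wU unfolding openin_pullback_topology by blast
    obtain F where F: "finite F" "F \<subseteq> mor \<Lambda>"
      and FU: "\<And>v. v \<in> path_space k \<Lambda> \<Longrightarrow>
        (\<And>y. y \<in> F \<Longrightarrow> v \<in> cylinder k \<Lambda> y \<longleftrightarrow> w \<in> cylinder k \<Lambda> y) \<Longrightarrow> v \<in> U"
      using initial_topology_neighbourhood[OF U wU] by blast
    obtain \<mu> G where \<mu>G: "\<mu> \<in> mor \<Lambda>" "finite G" "G \<subseteq> (\<Union>i<k. edges_from \<Lambda> (src \<Lambda> \<mu>) i)"
      and w\<mu>G: "w \<in> cylinder_diff k \<Lambda> \<mu> G"
      and eq: "\<And>v y. v \<in> cylinder_diff k \<Lambda> \<mu> G \<Longrightarrow> y \<in> F \<Longrightarrow>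
        v \<in> cylinder k \<Lambda> y \<longleftrightarrow> w \<in> cylinder k \<Lambda> y"
      using cylinder_diff_neighbourhood[OF assms(2) w F] by metis
    have "cylinder_diff k \<Lambda> \<mu> G \<subseteq> U"
    proof
      fix v
      assume v: "v \<in> cylinder_diff k \<Lambda> \<mu> G"
      then have "v \<in> path_space k \<Lambda>"
        by (auto simp: cylinder_diff_def cylinder_def)
      then show "v \<in> U"
        using eq[OF v] by (rule FU)
    qed
    moreover have "cylinder_diff k \<Lambda> \<mu> G \<in> ?B"
      using \<mu>G by blast
    ultimately show "\<exists>b\<in>?B. w \<in> b \<and> b \<subseteq> U"
      using w\<mu>G by (intro bexI conjI)
  qed
qed

end
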